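(* Let $\mathcal{A}$ be a unital Banach algebra with unit $1$ and let $d\in\mathcal{A}$. Then the set $\mathcal{A}^{-d}=\{a\in\mathcal{A}: a^{-d}\text{ exists}\}$ is open in $\mathcal{A}$. Furthermore, if $d\in\hat{\mathcal{A}}\setminus\{0\}$, $a\in\mathcal{A}^{-d}$ and $e\in\mathcal{A}$ is such that $\|e\|<\frac{1}{\|a^{-d}\|}$, then $a+e\in\mathcal{A}^{-d}$ and $$(a+e)^{-d}=(1+a^{-d}e)^{-1}a^{-d}=a^{-d}(1+ea^{-d})^{-1}.$$
   Context: The unit satisfies $\|1\|=1$. $\hat{\mathcal{A}}$ is the set of regular elements of $\mathcal{A}$, i.e. those $x$ with $x=xyx$ for some $y\in\mathcal{A}$. An element $a\in\mathcal{A}$ is invertible along $d\in\mathcal{A}$ if there exists $y\in\mathcal{A}$ such that $yay=y$, $y\mathcal{A}=d\mathcal{A}$ and $\mathcal{A}y=\mathcal{A}d$; such $y$ is unique when it exists and is denoted $a^{-d}$. *)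

theory Defs
  imports "HOL-Analysis.Analysis"
begin

definition regular_elements :: "'a::monoid_mult set" where
  "regular_elements = {x. \<exists>y. x = x * y * x}"

definition is_inverse_along :: "'a::monoid_mult \<Rightarrow> 'a \<Rightarrow> 'a \<Rightarrow> bool" where
  "is_inverse_along a d y \<longleftrightarrow>
     y * a * y = y \<and> range (\<lambda>x. y * x) = range (\<lambda>x. d * x) \<and> range (\<lambda>x. x * y) = range (\<lambda>x. x * d)"

definition invertible_along :: "'a::monoid_mult \<Rightarrow> 'a \<Rightarrow> bool" where
  "invertible_along a d \<longleftrightarrow> (\<exists>y. is_inverse_along a d y)"

(* Meaningful only if invertible_along a d; otherwise the value is unspecified. *)
definition inverse_along :: "'a::monoid_mult \<Rightarrow> 'a \<Rightarrow> 'a" where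
  "inverse_along a d = (THE y. is_inverse_along a d y)"

lemma is_inverse_along_unique:
  assumes "is_inverse_along a d y" and "is_inverse_along a d z"
  shows "y = z"
proof -
  have "z \<in> range (\<lambda>x. y * x)"
    using assms unfolding is_inverse_along_def by (metis mult_1_right rangeI)
  then obtain u where u: "z = y * u" by auto
  have "y \<in> range (\<lambda>x. x * z)"
    using assms unfolding is_inverse_along_def by (metis mult_1_left rangeI)
  then obtain v where v: "y = v * z" by auto
  have "y * a * z = z"
    using assms(1) u unfolding is_inverse_along_def by (metis mult.assoc)
  moreover have "y * a * z = y"
    using assms(2) v unfolding is_inverse_along_def by (metis mult.assoc)
  ultimately show ?thesis by simp
qed

lemma inverse_along_eq: "is_inverse_along a d y \<Longrightarrow> inverse_along a d = y"
  unfolding inverse_along_def by (blast intro: the_equality is_inverse_along_unique)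

(* The class constant inverse belongs to division rings and the like and carries no
   meaning in a general Banach algebra, hence the following. *)
definition has_two_sided_inverse :: "'a::monoid_mult \<Rightarrow> bool" where
  "has_two_sided_inverse x \<longleftrightarrow> (\<exists>y. x * y = 1 \<and> y * x = 1)"

(* Meaningful only if has_two_sided_inverse x; otherwise the value is unspecified. *)
definition two_sided_inverse :: "'a::monoid_mult \<Rightarrow> 'a" where
  "two_sided_inverse x = (THE y. x * y = 1 \<and> y * x = 1)"

lemma two_sided_inverse_eq:
  assumes "x * y = 1" and "y * x = 1"
  shows "two_sided_inverse x = y"
  unfolding two_sided_inverse_def
proof (rule the_equality)
  fix z assume "x * z = 1 \<and> z * x = 1"
  then show "z = y" using assms by (metis mult.assoc mult_1_left mult_1_right)
qed (use assms in simp)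

end

theory Submission
  imports Defs
begin

text \<open>If \<open>b\<close> is the inverse of \<open>a\<close> along \<open>d\<close> and \<open>\<parallel>e\<parallel> \<parallel>b\<parallel> < 1\<close>, both
  \<open>1 + b e\<close> and \<open>1 + e b\<close> are invertible by the Neumann series, and
  \<open>b (1 + e b) = (1 + b e) b\<close> shows that \<open>z = (1 + b e)\<inverse> b = b (1 + e b)\<inverse>\<close>. Since \<open>z\<close> arises from
  \<open>b\<close> by multiplying with a unit on either side, it generates the same one-sided ideals as \<open>b\<close>,
  and \<open>b (a + e) b = (1 + b e) b\<close> yields \<open>z (a + e) z = z\<close>.\<close>

text \<open>The tail of the geometric series from index 1 on is the sum minus 1, and also
  \<open>x\<close> times the sum, from either side.\<close>

lemma one_minus_neumann_series:
  fixes x :: "'a::{real_normed_algebra_1, banach}"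
  assumes "norm x < 1"
  shows "(1 - x) * (\<Sum>n. x ^ n) = 1" and "(\<Sum>n. x ^ n) * (1 - x) = 1"
proof -
  have s: "summable (\<lambda>n. x ^ n)"
    by (rule complete_algebra_summable_geometric[OF assms])
  have "(\<Sum>n. x ^ Suc n) = (\<Sum>n. x ^ n) - 1"
    using suminf_split_head[OF s] by simp
  moreover have "(\<Sum>n. x ^ Suc n) = x * (\<Sum>n. x ^ n)"
    using suminf_mult[OF s] by simp
  moreover have "(\<Sum>n. x ^ Suc n) = (\<Sum>n. x ^ n) * x"
    using suminf_mult2[OF s, of x] by (simp add: power_commutes)
  ultimately show "(1 - x) * (\<Sum>n. x ^ n) = 1" and "(\<Sum>n. x ^ n) * (1 - x) = 1"
    by (simp_all add: algebra_simps)
qed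

lemma has_two_sided_inverse_one_plus:
  fixes x :: "'a::{real_normed_algebra_1, banach}"
  assumes "norm x < 1"
  shows "has_two_sided_inverse (1 + x)"
  using one_minus_neumann_series[of "- x"] assms
  unfolding has_two_sided_inverse_def by auto

lemma two_sided_inverse_props:
  assumes "has_two_sided_inverse x"
  shows "x * two_sided_inverse x = 1" and "two_sided_inverse x * x = 1"
  using assms two_sided_inverse_eq unfolding has_two_sided_inverse_def by metis+

lemma range_mult_unit_right:
  fixes b :: "'a::monoid_mult"
  assumes "v * w = 1"
  shows "range (\<lambda>x. b * v * x) = range (\<lambda>x. b * x)"
proof (intro equalityI image_subsetI)
  fix x
  show "b * v * x \<in> range (\<lambda>x. b * x)"
    by (simp add: mult.assoc)
  have "b * x = b * v * (w * x)"
    using assms by (metis mult.assoc mult_1_left)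
  then show "b * x \<in> range (\<lambda>x. b * v * x)" by blast
qed

lemma range_mult_unit_left:
  fixes b :: "'a::monoid_mult"
  assumes "w * v = 1"
  shows "range (\<lambda>x. x * (v * b)) = range (\<lambda>x. x * b)"
proof (intro equalityI image_subsetI)
  fix x
  show "x * (v * b) \<in> range (\<lambda>x. x * b)"
    by (simp flip: mult.assoc)
  have "x * b = (x * w) * (v * b)"
    using assms by (metis mult.assoc mult_1_left)
  then show "x * b \<in> range (\<lambda>x. x * (v * b))" by blast
qed

lemma is_inverse_along_add:
  fixes a b d e :: "'a::ring_1"
  assumes b: "is_inverse_along a d b"
    and u: "(1 + b * e) * u = 1" "u * (1 + b * e) = 1"
    and v: "(1 + e * b) * v = 1" "v * (1 + e * b) = 1"
  shows "u * b = b * v" and "is_inverse_along (a + e) d (u * b)"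
proof -
  \<comment> \<open>Insert \<open>1 = (1 + e * b) * v\<close> on the right, so that the factor can
    be moved across \<open>b\<close> and cancelled by \<open>u\<close>.\<close>
  have "u * b = u * (b * (1 + e * b)) * v"
    using v(1) by (simp add: mult.assoc)
  also have "b * (1 + e * b) = (1 + b * e) * b"
    by (simp add: algebra_simps)
  finally show eq: "u * b = b * v"
    using u(2) by (simp flip: mult.assoc)
  have "b * (a + e) * b = (1 + b * e) * b"
    using b unfolding is_inverse_along_def by (simp add: algebra_simps)
  \<comment> \<open>Between \<open>u\<close> and \<open>v\<close> the right-hand side collapses to
    \<open>b * v\<close>, which is \<open>u * b\<close>.\<close>
  then have "u * (b * (a + e) * b) * v = u * b"
    using u(2) eq by (simp flip: mult.assoc)
  then have "u * b * (a + e) * (b * v) = u * b"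
    by (simp add: mult.assoc)
  then have "u * b * (a + e) * (u * b) = u * b"
    by (simp only: eq[symmetric])
  \<comment> \<open>For right ideals the unit must stand to the right of \<open>b\<close>, so
    \<open>u * b\<close> is read as \<open>b * v\<close>.\<close>
  moreover have "range (\<lambda>x. u * b * x) = range (\<lambda>x. d * x)"
    using b range_mult_unit_right[OF v(2), of b]
    unfolding is_inverse_along_def eq by simp
  moreover have "range (\<lambda>x. x * (u * b)) = range (\<lambda>x. x * d)"
    using b range_mult_unit_left[OF u(1), of b]
    unfolding is_inverse_along_def by simp
  ultimately show "is_inverse_along (a + e) d (u * b)"
    unfolding is_inverse_along_def by blast
qed

text \<open>Submultiplicativity of the norm makes both Neumann series converge. Stating the bound as
  a product also covers \<open>b = 0\<close>.\<close>

lemma inverse_along_perturbation: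
  fixes a b d e :: "'a::{real_normed_algebra_1, banach}"
  assumes b: "is_inverse_along a d b" and small: "norm e * norm b < 1"
  shows "has_two_sided_inverse (1 + b * e)" and "has_two_sided_inverse (1 + e * b)"
    and "is_inverse_along (a + e) d (two_sided_inverse (1 + b * e) * b)"
    and "two_sided_inverse (1 + b * e) * b = b * two_sided_inverse (1 + e * b)"
proof -
  have "norm (b * e) < 1" "norm (e * b) < 1"
    using small norm_mult_ineq[of b e] norm_mult_ineq[of e b] by (simp_all add: mult.commute)
  then show units: "has_two_sided_inverse (1 + b * e)" "has_two_sided_inverse (1 + e * b)"
    by (auto intro: has_two_sided_inverse_one_plus)
  show "is_inverse_along (a + e) d (two_sided_inverse (1 + b * e) * b)"
    and "two_sided_inverse (1 + b * e) * b = b * two_sided_inverse (1 + e * b)"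
    using is_inverse_along_add[OF b two_sided_inverse_props[OF units(1)]
        two_sided_inverse_props[OF units(2)]] by auto
qed

lemma open_invertible_along:
  fixes d :: "'a::{real_normed_algebra_1, banach}"
  shows "open {a. invertible_along a d}"
proof (rule openI)
  fix a assume "a \<in> {a. invertible_along a d}"
  then obtain b where b: "is_inverse_along a d b"
    by (auto simp: invertible_along_def)
  \<comment> \<open>The added 1 keeps the radius meaningful for \<open>b = 0\<close>, which happens
    when \<open>d = 0\<close>.\<close>
  define r where "r = 1 / (norm b + 1)"
  have "r > 0"
    unfolding r_def by (simp add: add_nonneg_pos)
  moreover have "invertible_along c d" if "c \<in> ball a r" for c
  proof -
    have "norm (c - a) * (norm b + 1) < 1"
      using that unfolding r_def
      by (simp add: dist_norm norm_minus_commute pos_less_divide_eq add_nonneg_pos)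
    then have "norm (c - a) * norm b < 1"
      using norm_ge_zero[of "c - a"] unfolding distrib_left by linarith
    \<comment> \<open>The perturbation is \<open>e = c - a\<close>, so that
      \<open>a + e = c\<close>.\<close>
    then show ?thesis
      using inverse_along_perturbation(3)[OF b, of "c - a"] by (auto simp: invertible_along_def)
  qed
  ultimately show "\<exists>r>0. ball a r \<subseteq> {a. invertible_along a d}"
    by blast
qed

theorem theorem4p2:
  fixes d :: "'a::{real_normed_algebra_1, banach}"
  shows "open {a. invertible_along a d} \<and>
    (d \<in> regular_elements - {0} \<longrightarrow>
      (\<forall>a e. invertible_along a d \<longrightarrow> norm e < 1 / norm (inverse_along a d) \<longrightarrow>
        invertible_along (a + e) d \<and>
        has_two_sided_inverse (1 + inverse_along a d * e) \<and>
        has_two_sided_inverse (1 + e * inverse_along a d) \<and>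
        inverse_along (a + e) d = two_sided_inverse (1 + inverse_along a d * e) * inverse_along a d \<and>
        inverse_along (a + e) d = inverse_along a d * two_sided_inverse (1 + e * inverse_along a d)))"
proof (intro conjI[OF open_invertible_along] impI allI)
  fix a e :: 'a
  assume "invertible_along a d" and small: "norm e < 1 / norm (inverse_along a d)"
  then obtain b where b: "is_inverse_along a d b"
    by (auto simp: invertible_along_def)
  have ab: "inverse_along a d = b"
    by (rule inverse_along_eq[OF b])
  \<comment> \<open>\<open>b \<noteq> 0\<close>, since otherwise \<open>1 / norm b = 0\<close> and no \<open>e\<close> satisfies the bound.\<close>
  have "b \<noteq> 0"
    using small ab by auto
  then have "norm e * norm b < 1"
    using small ab by (simp add: pos_less_divide_eq)
  note pert = inverse_along_perturbation[OF b this]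
  show "invertible_along (a + e) d \<and>
        has_two_sided_inverse (1 + inverse_along a d * e) \<and>
        has_two_sided_inverse (1 + e * inverse_along a d) \<and>
        inverse_along (a + e) d = two_sided_inverse (1 + inverse_along a d * e) * inverse_along a d \<and>
        inverse_along (a + e) d = inverse_along a d * two_sided_inverse (1 + e * inverse_along a d)"
    unfolding ab using pert inverse_along_eq[OF pert(3)]
    by (auto simp: invertible_along_def)
qed

end
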